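(* Let $h\in\omega^\omega$ with $h(n)\geq1$ for all but finitely many $n$. Then $\mathfrak{b}^{\mathrm{Lc}}_{\omega,h}=\min\{\mathfrak{b},\mathrm{minLc}_h\}$ and $\mathfrak{d}^{\mathrm{Lc}}_{\omega,h}=\max\{\mathfrak{d},\mathrm{supLc}_h\}$.
   Context: $\mathfrak{b}$ and $\mathfrak{d}$ are the unbounding and dominating numbers of $\langle\omega^\omega,\leq^*\rangle$. A natural number $k$ used as a set means $\{0,\dots,k-1\}$, and $\omega$ used for $b$ means the constant sequence $\omega$. For $b$ (in $\omega^\omega$ or $=\omega$) and $h\in\omega^\omega$: $\prod b=\prod_n b(n)$, $\mathcal{S}(b,h)=\prod_n[b(n)]^{\leq h(n)}$, and $x\in^*\varphi$ iff $x(n)\in\varphi(n)$ for all but finitely many $n$. $\mathfrak{b}^{\mathrm{Lc}}_{b,h}$ is the least size of $F\subseteq\prod b$ with no $\varphi\in\mathcal{S}(b,h)$ such that $x\in^*\varphi$ for all $x\in F$; $\mathfrak{d}^{\mathrm{Lc}}_{b,h}$ is the least size of $D\subseteq\mathcal{S}(b,h)$ such that every $x\in\prod b$ satisfies $x\in^*\varphi$ for some $\varphi\in D$. $\mathrm{minLc}_h=\min\{\mathfrak{b}^{\mathrm{Lc}}_{b,h}\}$ and $\mathrm{supLc}_h=\sup\{\mathfrak{d}^{\mathrm{Lc}}_{b,h}\}$, where $b$ ranges over $b\in\omega^\omega$ with $h(n)<b(n)$ for all but finitely many $n$. *)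

theory Defs
  imports "HOL-Library.Countable" "HOL-Library.FuncSet" "HOL-Library.Infinite_Set"
begin

unbundle cardinal_syntax

text \<open>
  Cardinals are represented, up to the relation \<open>=o\<close>, by cardinal orders on the type
  \<^typ>\<open>nat set\<close>, which has the size of the continuum.  All families considered here
  consist of elements of \<^typ>\<open>nat \<Rightarrow> nat\<close> or \<^typ>\<open>nat \<Rightarrow> nat set\<close>, so every size that
  occurs has a representative on this type.
\<close>

type_synonym cardinal = "nat set rel"

text \<open>
  The second case is a convention: if there is no family at all, so that the least size does
  not exist, the value is the continuum, the largest cardinal of this representation. Such
  a value never affects a minimum taken together with existing least sizes.
\<close>

definition least_size :: "'a set set \<Rightarrow> cardinal" where
  "least_size \<A> =
     (if \<A> \<noteq> {}
      then SOME \<kappa>. (\<exists>A\<in>\<A>. \<kappa> =o |A| ) \<and> (\<forall>A\<in>\<A>. \<kappa> \<le>o |A| )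
      else |UNIV :: nat set set| )"

definition card_min :: "cardinal set \<Rightarrow> cardinal" where
  "card_min R = (SOME \<kappa>. \<kappa> \<in> R \<and> (\<forall>\<mu>\<in>R. \<kappa> \<le>o \<mu>))"

definition card_max :: "cardinal set \<Rightarrow> cardinal" where
  "card_max R = (SOME \<kappa>. \<kappa> \<in> R \<and> (\<forall>\<mu>\<in>R. \<mu> \<le>o \<kappa>))"

definition card_sup :: "cardinal set \<Rightarrow> cardinal" where
  "card_sup R = (SOME \<kappa>. Card_order \<kappa> \<and> (\<forall>\<mu>\<in>R. \<mu> \<le>o \<kappa>) \<and>
     (\<forall>\<nu>::cardinal. Card_order \<nu> \<and> (\<forall>\<mu>\<in>R. \<mu> \<le>o \<nu>) \<longrightarrow> \<kappa> \<le>o \<nu>))"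

definition le_star :: "(nat \<Rightarrow> nat) \<Rightarrow> (nat \<Rightarrow> nat) \<Rightarrow> bool" (infix \<open>\<le>\<^sup>*\<close> 50) where
  "x \<le>\<^sup>* y \<longleftrightarrow> (\<forall>\<^sub>\<infinity>n. x n \<le> y n)"

definition unbounding_number :: cardinal (\<open>\<bb>\<close>) where
  "\<bb> = least_size {F. \<not> (\<exists>y. \<forall>x\<in>F. x \<le>\<^sup>* y)}"

definition dominating_number :: cardinal (\<open>\<dd>\<close>) where
  "\<dd> = least_size {D. \<forall>x. \<exists>y\<in>D. x \<le>\<^sup>* y}"

text \<open>
  The parameter \<open>b\<close> is a sequence of subsets of \<open>\<omega>\<close>: a function \<open>b \<in> \<omega>\<^sup>\<omega>\<close> enters as
  \<open>\<lambda>n. {..<b n}\<close>, and the constant sequence \<open>\<omega>\<close> as \<open>\<lambda>_. UNIV\<close>.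
\<close>

definition slaloms :: "(nat \<Rightarrow> nat set) \<Rightarrow> (nat \<Rightarrow> nat) \<Rightarrow> (nat \<Rightarrow> nat set) set" where
  "slaloms b h = Pi UNIV (\<lambda>n. {s. s \<subseteq> b n \<and> finite s \<and> card s \<le> h n})"

definition in_star :: "(nat \<Rightarrow> nat) \<Rightarrow> (nat \<Rightarrow> nat set) \<Rightarrow> bool" (infix \<open>\<in>\<^sup>*\<close> 50) where
  "x \<in>\<^sup>* \<phi> \<longleftrightarrow> (\<forall>\<^sub>\<infinity>n. x n \<in> \<phi> n)"

definition bLc :: "(nat \<Rightarrow> nat set) \<Rightarrow> (nat \<Rightarrow> nat) \<Rightarrow> cardinal" where
  "bLc b h = least_size {F. F \<subseteq> Pi UNIV b \<and> \<not> (\<exists>\<phi>\<in>slaloms b h. \<forall>x\<in>F. x \<in>\<^sup>* \<phi>)}"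

definition dLc :: "(nat \<Rightarrow> nat set) \<Rightarrow> (nat \<Rightarrow> nat) \<Rightarrow> cardinal" where
  "dLc b h = least_size {D. D \<subseteq> slaloms b h \<and> (\<forall>x\<in>Pi UNIV b. \<exists>\<phi>\<in>D. x \<in>\<^sup>* \<phi>)}"

definition minLc :: "(nat \<Rightarrow> nat) \<Rightarrow> cardinal" where
  "minLc h = card_min {bLc (\<lambda>n. {..<b n}) h | b. \<forall>\<^sub>\<infinity>n. h n < b n}"

definition supLc :: "(nat \<Rightarrow> nat) \<Rightarrow> cardinal" where
  "supLc h = card_sup {dLc (\<lambda>n. {..<b n}) h | b. \<forall>\<^sub>\<infinity>n. h n < b n}"

text \<open>
  The choices above are well defined: on the arguments that occur, the chosen cardinal exists
  and is determined up to \<open>=o\<close>; the supremum is least among the cardinal orders on any type.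
\<close>

lemma exists_minim_Card_order:
  assumes "R \<noteq> {}" "\<forall>r\<in>R. Card_order r"
  shows "\<exists>r\<in>R. \<forall>r'\<in>R. r \<le>o r'"
  using assms exists_minim_Well_order[of R] by (auto simp: card_order_on_def)

lemma card_min:
  assumes "R \<noteq> {}" "\<forall>\<mu>\<in>R. Card_order \<mu>"
  shows "card_min R \<in> R \<and> (\<forall>\<mu>\<in>R. card_min R \<le>o \<mu>)"
proof -
  have "\<exists>\<kappa>. \<kappa> \<in> R \<and> (\<forall>\<mu>\<in>R. \<kappa> \<le>o \<mu>)"
    using exists_minim_Card_order[OF assms] by blast
  from someI_ex[OF this] show ?thesis
    unfolding card_min_def .
qed

lemma least_size:
  fixes \<A> :: "'a set set"
  assumes "\<A> \<noteq> {}" and "|UNIV :: 'a set| \<le>o |UNIV :: nat set set|"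
  shows "(\<exists>A\<in>\<A>. least_size \<A> =o |A| ) \<and> (\<forall>A\<in>\<A>. least_size \<A> \<le>o |A| )"
proof -
  have "card_of ` \<A> \<noteq> {}" "\<forall>r\<in>card_of ` \<A>. Card_order r"
    using assms(1) card_of_Card_order by blast+
  then obtain A where A: "A \<in> \<A>" "\<forall>B\<in>\<A>. |A| \<le>o |B|"
    using exists_minim_Card_order[of "card_of ` \<A>"] by auto
  have "|A| \<le>o |UNIV :: nat set set|"
    by (rule ordLeq_transitive[OF card_of_mono1[OF subset_UNIV] assms(2)])
  from internalize_card_of_ordLeq2[THEN iffD1, OF this]
  obtain B :: "nat set set" where B: "|A| =o |B|" by blast
  have "\<exists>\<kappa>::cardinal. (\<exists>A\<in>\<A>. \<kappa> =o |A| ) \<and> (\<forall>A\<in>\<A>. \<kappa> \<le>o |A| )"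
    using A ordIso_symmetric[OF B] ordIso_ordLeq_trans[OF ordIso_symmetric[OF B]] by blast
  from someI_ex[OF this] show ?thesis
    using assms(1) by (simp add: least_size_def)
qed

lemma card_max_pair:
  assumes "Card_order \<kappa>" "Card_order \<mu>"
  shows "card_max {\<kappa>, \<mu>} \<in> {\<kappa>, \<mu>} \<and> \<kappa> \<le>o card_max {\<kappa>, \<mu>} \<and> \<mu> \<le>o card_max {\<kappa>, \<mu>}"
proof -
  have w: "Well_order \<kappa>" "Well_order \<mu>"
    using assms by (auto simp: card_order_on_def)
  then have "\<exists>\<nu>. \<nu> \<in> {\<kappa>, \<mu>} \<and> (\<forall>\<mu>'\<in>{\<kappa>, \<mu>}. \<mu>' \<le>o \<nu>)"
    using ordLeq_total[OF w] ordLeq_reflexive by auto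
  from someI_ex[OF this] show ?thesis
    unfolding card_max_def by auto
qed

lemma card_sup:
  assumes "\<forall>\<mu>\<in>R. Card_order \<mu>"
  shows "Card_order (card_sup R)"
    and "\<mu> \<in> R \<Longrightarrow> \<mu> \<le>o card_sup R"
    and "\<lbrakk>Card_order (\<nu> :: 'b rel); \<forall>\<mu>\<in>R. \<mu> \<le>o \<nu>\<rbrakk> \<Longrightarrow> card_sup R \<le>o \<nu>"
proof -
  let ?U = "{\<nu>::cardinal. Card_order \<nu> \<and> (\<forall>\<mu>\<in>R. \<mu> \<le>o \<nu>)}"
  have top: "\<mu> \<le>o |UNIV :: nat set set|" if "Card_order \<mu>" for \<mu> :: cardinal
    by (rule ordIso_ordLeq_trans[OF ordIso_symmetric[OF card_of_Field_ordIso[OF that]]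
          card_of_mono1[OF subset_UNIV]])
  have "|UNIV :: nat set set| \<in> ?U"
    using top assms card_of_Card_order[of UNIV] by (intro CollectI conjI ballI) auto
  then have "\<exists>\<kappa>\<in>?U. \<forall>\<nu>\<in>?U. \<kappa> \<le>o \<nu>"
    using exists_minim_Card_order[of ?U] by blast
  then have ex: "\<exists>\<kappa>::cardinal. Card_order \<kappa> \<and> (\<forall>\<mu>\<in>R. \<mu> \<le>o \<kappa>) \<and>
     (\<forall>\<nu>::cardinal. Card_order \<nu> \<and> (\<forall>\<mu>\<in>R. \<mu> \<le>o \<nu>) \<longrightarrow> \<kappa> \<le>o \<nu>)"
    by blast
  have s: "Card_order (card_sup R) \<and> (\<forall>\<mu>\<in>R. \<mu> \<le>o card_sup R) \<and>
     (\<forall>\<nu>::cardinal. Card_order \<nu> \<and> (\<forall>\<mu>\<in>R. \<mu> \<le>o \<nu>) \<longrightarrow> card_sup R \<le>o \<nu>)"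
    unfolding card_sup_def by (rule someI_ex[OF ex])
  show "Card_order (card_sup R)" using s by blast
  show "\<mu> \<in> R \<Longrightarrow> \<mu> \<le>o card_sup R" using s by blast
  show "card_sup R \<le>o \<nu>" if \<nu>: "Card_order \<nu>" "\<forall>\<mu>\<in>R. \<mu> \<le>o \<nu>" for \<nu> :: "'b rel"
  proof (rule ccontr)
    assume n: "\<not> card_sup R \<le>o \<nu>"
    have "\<nu> \<le>o card_sup R"
      using n s \<nu>(1) ordLeq_total[of \<nu> "card_sup R"] by (auto simp: card_order_on_def)
    moreover have "card_sup R \<le>o |UNIV :: nat set set|"
      using s top by blast
    ultimately have "\<nu> \<le>o |UNIV :: nat set set|"
      by (rule ordLeq_transitive)
    then have "|Field \<nu>| \<le>o |UNIV :: nat set set|"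
      by (rule ordIso_ordLeq_trans[OF card_of_Field_ordIso[OF \<nu>(1)]])
    from internalize_card_of_ordLeq2[THEN iffD1, OF this]
    obtain B :: "nat set set" where "|Field \<nu>| =o |B|" by blast
    then have B: "\<nu> =o |B|"
      by (rule ordIso_transitive[OF ordIso_symmetric[OF card_of_Field_ordIso[OF \<nu>(1)]]])
    then have "card_sup R \<le>o |B|"
      using s \<nu>(2) ordLeq_ordIso_trans[OF _ B] card_of_Card_order[of B] by blast
    then show False
      using n ordLeq_ordIso_trans[OF _ ordIso_symmetric[OF B]] by blast
  qed
qed

lemma card_of_fun_le: "|UNIV :: (nat \<Rightarrow> nat) set| \<le>o |UNIV :: nat set set|"
proof -
  obtain e :: "nat \<times> nat \<Rightarrow> nat" where e: "inj e"
    using inj_to_nat by blast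
  have "inj (\<lambda>f::nat \<Rightarrow> nat. e ` {(n, f n) | n. True})"
  proof (rule injI)
    fix f g :: "nat \<Rightarrow> nat"
    assume "e ` {(n, f n) | n. True} = e ` {(n, g n) | n. True}"
    then have "{(n, f n) | n. True} = {(n, g n) | n. True}"
      using e by (simp add: inj_image_eq_iff)
    then show "f = g" by (auto simp: set_eq_iff fun_eq_iff)
  qed
  then show ?thesis
    by (intro card_of_ordLeq[THEN iffD1] exI conjI) auto
qed

lemma card_of_set_fun_le: "|UNIV :: (nat \<Rightarrow> nat set) set| \<le>o |UNIV :: nat set set|"
proof -
  obtain e :: "nat \<times> nat \<Rightarrow> nat" where e: "inj e"
    using inj_to_nat by blast
  have "inj (\<lambda>f::nat \<Rightarrow> nat set. e ` {(n, k) | n k. k \<in> f n})"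
  proof (rule injI)
    fix f g :: "nat \<Rightarrow> nat set"
    assume "e ` {(n, k) | n k. k \<in> f n} = e ` {(n, k) | n k. k \<in> g n}"
    then have "{(n, k) | n k. k \<in> f n} = {(n, k) | n k. k \<in> g n}"
      using e by (simp add: inj_image_eq_iff)
    then show "f = g" by (auto simp: set_eq_iff fun_eq_iff)
  qed
  then show ?thesis
    by (intro card_of_ordLeq[THEN iffD1] exI conjI) auto
qed

end

theory Submission
  imports Defs
begin

text \<open>
  A slalom localizing \<open>x\<close> bounds \<open>x\<close> by its pointwise maximum, and intersecting it with \<open>b\<close>
  localizes \<open>x\<close> inside \<open>\<Prod>b\<close>; this gives one inequality for each cardinal. Conversely, once a
  family of reals is bounded by \<open>y\<close>, it lives, up to finitely many values, in \<open>\<Prod>b\<close> for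
  \<open>b = max y h + 1\<close>, where it can be localized by slaloms in \<open>\<S>(b,h)\<close>. For \<open>\<dd>\<close>, one takes the
  union of localizing families over all \<open>y\<close> in a dominating family, which is infinite.
\<close>

section \<open>Comparison of least sizes\<close>

lemma Card_order_least_size:
  fixes \<A> :: "'a set set"
  assumes "|UNIV :: 'a set| \<le>o |UNIV :: nat set set|"
  shows "Card_order (least_size \<A>)"
proof (cases "\<A> = {}")
  case True
  then show ?thesis by (simp add: least_size_def card_of_Card_order)
next
  case False
  then obtain A :: "'a set" where "least_size \<A> =o |A|"
    using least_size[OF _ assms] by blast
  then show ?thesis
    using Card_order_ordIso[OF card_of_Card_order] by blast
qed

lemma least_size_le:
  fixes \<A> :: "'a set set"
  assumes "|UNIV :: 'a set| \<le>o |UNIV :: nat set set|" "A \<in> \<A>"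
  shows "least_size \<A> \<le>o |A|"
proof -
  have "\<A> \<noteq> {}" using assms(2) by auto
  from least_size[OF this assms(1)] assms(2) show ?thesis by simp
qed

text \<open>A smallest member of \<open>\<B>\<close> is replaced by a member of \<open>\<A>\<close>
  that is no larger. The case of empty \<open>\<B>\<close> does occur: if some \<open>b n\<close> is
  empty, so is the product, no family witnesses \<open>bLc b h\<close>, and its value is the
  continuum, which bounds the size of every member of \<open>\<A>\<close>.\<close>

lemma least_size_mono:
  fixes \<A> :: "'a set set" and \<B> :: "'b set set"
  assumes "|UNIV :: 'a set| \<le>o |UNIV :: nat set set|"
    and "|UNIV :: 'b set| \<le>o |UNIV :: nat set set|"
    and "\<A> \<noteq> {}"
    and "\<And>B. B \<in> \<B> \<Longrightarrow> \<exists>A\<in>\<A>. |A| \<le>o |B|"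
  shows "least_size \<A> \<le>o least_size \<B>"
proof (cases "\<B> = {}")
  case True
  obtain A where "A \<in> \<A>" using assms(3) by blast
  then have "least_size \<A> \<le>o |A|" by (rule least_size_le[OF assms(1)])
  also have "|A| \<le>o |UNIV :: 'a set|" by (rule card_of_mono1) simp
  also note assms(1)
  finally show ?thesis using True by (simp add: least_size_def)
next
  case False
  obtain B where B: "B \<in> \<B>" "least_size \<B> =o |B|"
    using least_size[OF False assms(2)] by blast
  obtain A where A: "A \<in> \<A>" "|A| \<le>o |B|" using assms(4) B(1) by blast
  have "least_size \<A> \<le>o |A|" using A(1) by (rule least_size_le[OF assms(1)])
  also note A(2)
  also have "|B| =o least_size \<B>" using B(2) by (rule ordIso_symmetric)
  finally show ?thesis .
qed

lemma card_min_pair: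
  assumes "Card_order \<kappa>" "Card_order \<mu>"
  shows "card_min {\<kappa>, \<mu>} \<in> {\<kappa>, \<mu>} \<and> card_min {\<kappa>, \<mu>} \<le>o \<kappa> \<and> card_min {\<kappa>, \<mu>} \<le>o \<mu>"
  using card_min[of "{\<kappa>, \<mu>}"] assms by blast

section \<open>Slaloms: bounding, restriction, truncation and localization\<close>

lemma in_star_le_star_Max:
  assumes "\<phi> \<in> slaloms (\<lambda>_. UNIV) h" "x \<in>\<^sup>* \<phi>"
  shows "x \<le>\<^sup>* (\<lambda>n. Max (\<phi> n))"
  using assms(2) unfolding in_star_def le_star_def
proof eventually_elim
  case (elim n)
  \<comment> \<open>At these n the set contains \<open>x n\<close>, so \<open>Max\<close> is never
    evaluated on the empty set.\<close>
  have "finite (\<phi> n)" using assms(1) by (auto simp: slaloms_def)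
  with elim show ?case by simp
qed

lemma slaloms_restrict:
  assumes "\<phi> \<in> slaloms (\<lambda>_. UNIV) h"
  shows "(\<lambda>n. \<phi> n \<inter> b n) \<in> slaloms b h"
proof -
  have "card (\<phi> n \<inter> b n) \<le> h n" for n
  proof -
    have "card (\<phi> n \<inter> b n) \<le> card (\<phi> n)"
      using assms by (intro card_mono) (auto simp: slaloms_def)
    also have "\<dots> \<le> h n" using assms by (auto simp: slaloms_def)
    finally show ?thesis .
  qed
  then show ?thesis using assms by (auto simp: slaloms_def)
qed

lemma slaloms_mono: "\<phi> \<in> slaloms b h \<Longrightarrow> (\<And>n. b n \<subseteq> c n) \<Longrightarrow> \<phi> \<in> slaloms c h"
  by (fastforce simp: slaloms_def)

lemma in_star_restrict: "x \<in>\<^sup>* \<phi> \<Longrightarrow> x \<in> Pi UNIV b \<Longrightarrow> x \<in>\<^sup>* (\<lambda>n. \<phi> n \<inter> b n)"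
  by (auto simp: in_star_def Pi_def elim: MOST_mono)

text \<open>Capping moves every real into a bounded product, with no condition on x. If
  \<open>x \<le>\<^sup>* y\<close>, only finitely many values change, which localization
  ignores.\<close>

definition truncate :: "(nat \<Rightarrow> nat) \<Rightarrow> (nat \<Rightarrow> nat) \<Rightarrow> nat \<Rightarrow> nat" where
  "truncate y x = (\<lambda>n. min (x n) (y n))"

text \<open>Taking the maximum with \<open>h n\<close> and then the successor keeps the bound
  strictly above h, so that it is among the sequences over which \<open>minLc h\<close> and
  \<open>supLc h\<close> range.\<close>

lemma truncate_in_Pi: "truncate y x \<in> Pi UNIV (\<lambda>n. {..<Suc (max (y n) (h n))})"
  by (auto simp: truncate_def)

lemma in_star_truncate: "x \<le>\<^sup>* y \<Longrightarrow> truncate y x \<in>\<^sup>* \<phi> \<Longrightarrow> x \<in>\<^sup>* \<phi>"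
  unfolding le_star_def in_star_def truncate_def
  by (drule (1) MOST_conjI) (auto simp: min_def elim: MOST_mono)

text \<open>Diagonalization: the real lying one above the maximum of each \<open>\<phi> n\<close>
  escapes \<open>\<phi>\<close>.\<close>

lemma not_localizable_UNIV: "\<not> (\<exists>\<phi>\<in>slaloms (\<lambda>_. UNIV) h. \<forall>x. x \<in>\<^sup>* \<phi>)"
proof
  assume "\<exists>\<phi>\<in>slaloms (\<lambda>_. UNIV) h. \<forall>x. x \<in>\<^sup>* \<phi>"
  then obtain \<phi> where \<phi>: "\<phi> \<in> slaloms (\<lambda>_. UNIV) h" "(\<lambda>n. Suc (Max (\<phi> n))) \<in>\<^sup>* \<phi>"
    by blast
  from in_star_le_star_Max[OF this] show False
    by (simp add: le_star_def)
qed

text \<open>Ensures that \<open>bLc (\<lambda>_. UNIV) h\<close> is attained by an actual family and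
  is not the default value.\<close>

lemma not_localizable_families_nonempty:
  "{F. F \<subseteq> Pi UNIV (\<lambda>_. UNIV) \<and> \<not> (\<exists>\<phi>\<in>slaloms (\<lambda>_. UNIV) h. \<forall>x\<in>F. x \<in>\<^sup>* \<phi>)} \<noteq> {}"
  (is "?\<A> \<noteq> {}")
proof -
  have "UNIV \<in> ?\<A>" using not_localizable_UNIV by simp
  then show ?thesis unfolding ex_in_conv[symmetric] by (rule exI)
qed

lemma le_star_refl: "x \<le>\<^sup>* x"
  by (simp add: le_star_def)

text \<open>The pointwise sum of a finite family, plus one, exceeds each member everywhere. Infinity
  of D is what later makes the union of localizing families no larger than its bound.\<close>

lemma infinite_dominating:
  assumes "\<forall>x. \<exists>y\<in>D. x \<le>\<^sup>* y"
  shows "infinite D"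
proof
  assume fin: "finite D"
  obtain y where y: "y \<in> D" "(\<lambda>n. Suc (\<Sum>z\<in>D. z n)) \<le>\<^sup>* y" using assms by blast
  have "y n \<le> (\<Sum>z\<in>D. z n)" for n
    using fin y(1) by (intro member_le_sum) auto
  then have "\<not> Suc (\<Sum>z\<in>D. z n) \<le> y n" for n by (simp add: not_less_eq_eq)
  with y(2) show False by (simp add: le_star_def)
qed

lemma slaloms_localizing:
  assumes "\<forall>\<^sub>\<infinity>n. h n \<ge> 1" "x \<in> Pi UNIV b"
  shows "\<exists>\<phi>\<in>slaloms b h. x \<in>\<^sup>* \<phi>"
proof
  \<comment> \<open>Where \<open>h n = 0\<close> only the empty set is admissible; this happens at
    finitely many n.\<close>
  let ?\<phi> = "\<lambda>n. if h n \<ge> 1 then {x n} else {}"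
  show "?\<phi> \<in> slaloms b h" using assms(2) by (auto simp: slaloms_def split: if_splits)
  show "x \<in>\<^sup>* ?\<phi>" using assms(1) unfolding in_star_def by (auto elim: MOST_mono)
qed

section \<open>The invariants as cardinals; bounds for \<open>minLc\<close> and
  \<open>supLc\<close>\<close>

lemma Card_order_bLc: "Card_order (bLc b h)"
  unfolding bLc_def by (rule Card_order_least_size[OF card_of_fun_le])

lemma Card_order_dLc: "Card_order (dLc b h)"
  unfolding dLc_def by (rule Card_order_least_size[OF card_of_set_fun_le])

lemma Card_order_unbounding_number: "Card_order \<bb>"
  unfolding unbounding_number_def by (rule Card_order_least_size[OF card_of_fun_le])

lemma Card_order_dominating_number: "Card_order \<dd>"
  unfolding dominating_number_def by (rule Card_order_least_size[OF card_of_fun_le])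

lemma minLc:
  shows "\<exists>b. (\<forall>\<^sub>\<infinity>n. h n < b n) \<and> minLc h = bLc (\<lambda>n. {..<b n}) h"
    and "\<forall>\<^sub>\<infinity>n. h n < b n \<Longrightarrow> minLc h \<le>o bLc (\<lambda>n. {..<b n}) h"
proof -
  let ?R = "{bLc (\<lambda>n. {..<b n}) h | b. \<forall>\<^sub>\<infinity>n. h n < b n}"
  \<comment> \<open>The sequence h + 1 shows that the minimum is taken over a nonempty set.\<close>
  have "bLc (\<lambda>n. {..<Suc (h n)}) h \<in> ?R" by (intro CollectI exI[of _ "\<lambda>n. Suc (h n)"]) simp
  then have "?R \<noteq> {}" unfolding ex_in_conv[symmetric] by (rule exI)
  moreover have "\<forall>\<mu>\<in>?R. Card_order \<mu>" by (auto simp: Card_order_bLc)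
  ultimately have *: "minLc h \<in> ?R \<and> (\<forall>\<mu>\<in>?R. minLc h \<le>o \<mu>)"
    unfolding minLc_def by (rule card_min)
  then show "\<exists>b. (\<forall>\<^sub>\<infinity>n. h n < b n) \<and> minLc h = bLc (\<lambda>n. {..<b n}) h" by blast
  show "\<forall>\<^sub>\<infinity>n. h n < b n \<Longrightarrow> minLc h \<le>o bLc (\<lambda>n. {..<b n}) h" using * by blast
qed

lemma Card_order_minLc: "Card_order (minLc h)"
  using minLc(1)[of h] Card_order_bLc by metis

lemma Card_order_supLc: "Card_order (supLc h)"
  unfolding supLc_def by (rule card_sup(1)) (auto simp: Card_order_dLc)

lemma dLc_le_supLc: "\<forall>\<^sub>\<infinity>n. h n < b n \<Longrightarrow> dLc (\<lambda>n. {..<b n}) h \<le>o supLc h"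
  unfolding supLc_def by (rule card_sup(2)) (auto simp: Card_order_dLc)

lemma supLc_least:
  assumes "Card_order \<nu>" "\<And>b. \<forall>\<^sub>\<infinity>n. h n < b n \<Longrightarrow> dLc (\<lambda>n. {..<b n}) h \<le>o \<nu>"
  shows "supLc h \<le>o \<nu>"
  unfolding supLc_def by (rule card_sup(3)) (auto simp: Card_order_dLc assms)

section \<open>The unbounding side\<close>

lemma bLc_UNIV_le_unbounding_number: "bLc (\<lambda>_. UNIV) h \<le>o \<bb>"
  unfolding bLc_def unbounding_number_def
proof (rule least_size_mono[OF card_of_fun_le card_of_fun_le])
  let ?\<A> = "{F. F \<subseteq> Pi UNIV (\<lambda>_. UNIV) \<and> \<not> (\<exists>\<phi>\<in>slaloms (\<lambda>_. UNIV) h. \<forall>x\<in>F. x \<in>\<^sup>* \<phi>)}"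
  show "?\<A> \<noteq> {}"
    by (rule not_localizable_families_nonempty)
  fix F :: "(nat \<Rightarrow> nat) set"
  assume "F \<in> {F. \<not> (\<exists>y. \<forall>x\<in>F. x \<le>\<^sup>* y)}"
  then have unb: "\<nexists>y. \<forall>x\<in>F. x \<le>\<^sup>* y" by simp
  \<comment> \<open>One slalom for all of F would give one bound for all of F, so F itself is the
    required witness.\<close>
  have "\<not> (\<exists>\<phi>\<in>slaloms (\<lambda>_. UNIV) h. \<forall>x\<in>F. x \<in>\<^sup>* \<phi>)"
  proof
    assume "\<exists>\<phi>\<in>slaloms (\<lambda>_. UNIV) h. \<forall>x\<in>F. x \<in>\<^sup>* \<phi>"
    then obtain \<phi> where \<phi>: "\<phi> \<in> slaloms (\<lambda>_. UNIV) h" "\<forall>x\<in>F. x \<in>\<^sup>* \<phi>" ..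
    then have "\<forall>x\<in>F. x \<le>\<^sup>* (\<lambda>n. Max (\<phi> n))" by (simp add: in_star_le_star_Max)
    then show False using unb by metis
  qed
  then have "F \<in> ?\<A>" by simp
  then show "\<exists>A\<in>?\<A>. |A| \<le>o |F|" by (rule bexI[rotated]) (rule card_of_mono1, simp)
qed

text \<open>Unrestricted slaloms localize no more subfamilies of the product than slaloms inside b
  do, since the trace on b of a localizing slalom still localizes.\<close>

lemma bLc_UNIV_le_bLc: "bLc (\<lambda>_. UNIV) h \<le>o bLc b h"
  unfolding bLc_def
proof (rule least_size_mono[OF card_of_fun_le card_of_fun_le])
  let ?\<A> = "{F. F \<subseteq> Pi UNIV (\<lambda>_. UNIV) \<and> \<not> (\<exists>\<phi>\<in>slaloms (\<lambda>_. UNIV) h. \<forall>x\<in>F. x \<in>\<^sup>* \<phi>)}"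
  show "?\<A> \<noteq> {}"
    by (rule not_localizable_families_nonempty)
  fix F
  assume F: "F \<in> {F. F \<subseteq> Pi UNIV b \<and> \<not> (\<exists>\<phi>\<in>slaloms b h. \<forall>x\<in>F. x \<in>\<^sup>* \<phi>)}"
  have "\<not> (\<exists>\<phi>\<in>slaloms (\<lambda>_. UNIV) h. \<forall>x\<in>F. x \<in>\<^sup>* \<phi>)"
  proof
    assume "\<exists>\<phi>\<in>slaloms (\<lambda>_. UNIV) h. \<forall>x\<in>F. x \<in>\<^sup>* \<phi>"
    then obtain \<phi> where \<phi>: "\<phi> \<in> slaloms (\<lambda>_. UNIV) h" "\<forall>x\<in>F. x \<in>\<^sup>* \<phi>" ..
    have "\<forall>x\<in>F. x \<in>\<^sup>* (\<lambda>n. \<phi> n \<inter> b n)"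
      using F \<phi>(2) in_star_restrict[of _ \<phi> b] by blast
    with slaloms_restrict[OF \<phi>(1), of b] F show False by blast
  qed
  then have "F \<in> ?\<A>" by simp
  then show "\<exists>A\<in>?\<A>. |A| \<le>o |F|" by (rule bexI[rotated]) (rule card_of_mono1, simp)
qed

text \<open>A smallest non-localizable F is either unbounded, hence counted by \<open>\<bb>\<close>,
  or bounded by some y; then its truncations at y form a non-localizable family in a bounded
  product.\<close>

lemma unbounding_number_le_or_minLc_le:
  "\<bb> \<le>o bLc (\<lambda>_. UNIV) h \<or> minLc h \<le>o bLc (\<lambda>_. UNIV) h"
proof -
  let ?\<A> = "{F. F \<subseteq> Pi UNIV (\<lambda>_. UNIV) \<and> \<not> (\<exists>\<phi>\<in>slaloms (\<lambda>_. UNIV) h. \<forall>x\<in>F. x \<in>\<^sup>* \<phi>)}"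
  have "?\<A> \<noteq> {}" by (rule not_localizable_families_nonempty)
  from least_size[OF this card_of_fun_le] obtain F
    where "F \<in> ?\<A>" and F_size: "bLc (\<lambda>_. UNIV) h =o |F|"
    unfolding bLc_def by blast
  then have F: "\<not> (\<exists>\<phi>\<in>slaloms (\<lambda>_. UNIV) h. \<forall>x\<in>F. x \<in>\<^sup>* \<phi>)" by blast
  have "\<bb> \<le>o |F| \<or> minLc h \<le>o |F|"
  proof (cases "\<exists>y. \<forall>x\<in>F. x \<le>\<^sup>* y")
    case False
    then have "F \<in> {F. \<not> (\<exists>y. \<forall>x\<in>F. x \<le>\<^sup>* y)}" by blast
    then have "\<bb> \<le>o |F|"
      unfolding unbounding_number_def by (rule least_size_le[OF card_of_fun_le])
    then show ?thesis ..
  next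
    case True
    then obtain y where y: "\<And>x. x \<in> F \<Longrightarrow> x \<le>\<^sup>* y" by blast
    let ?b = "\<lambda>n. Suc (max (y n) (h n))"
    let ?\<B> = "{F. F \<subseteq> Pi UNIV (\<lambda>n. {..<?b n}) \<and>
      \<not> (\<exists>\<phi>\<in>slaloms (\<lambda>n. {..<?b n}) h. \<forall>x\<in>F. x \<in>\<^sup>* \<phi>)}"
    have "\<not> (\<exists>\<phi>\<in>slaloms (\<lambda>n. {..<?b n}) h. \<forall>x\<in>truncate y ` F. x \<in>\<^sup>* \<phi>)"
    proof
      assume "\<exists>\<phi>\<in>slaloms (\<lambda>n. {..<?b n}) h. \<forall>x\<in>truncate y ` F. x \<in>\<^sup>* \<phi>"
      then obtain \<phi> where \<phi>: "\<phi> \<in> slaloms (\<lambda>n. {..<?b n}) h"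
        "\<And>x. x \<in> F \<Longrightarrow> truncate y x \<in>\<^sup>* \<phi>" by blast
      \<comment> \<open>A slalom for the truncations would localize F itself, because each member of
        F agrees with its truncation almost everywhere.\<close>
      have "\<phi> \<in> slaloms (\<lambda>_. UNIV) h" by (rule slaloms_mono[OF \<phi>(1)]) simp
      moreover have "\<forall>x\<in>F. x \<in>\<^sup>* \<phi>" using y \<phi>(2) in_star_truncate by blast
      ultimately show False using F by blast
    qed
    then have "truncate y ` F \<in> ?\<B>" using truncate_in_Pi by (simp add: image_subset_iff)
    then have "bLc (\<lambda>n. {..<?b n}) h \<le>o |truncate y ` F|"
      unfolding bLc_def by (rule least_size_le[OF card_of_fun_le])
    moreover have "minLc h \<le>o bLc (\<lambda>n. {..<?b n}) h"
      by (rule minLc(2)) (simp add: less_Suc_eq_le)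
    ultimately have "minLc h \<le>o |F|"
      using ordLeq_transitive[OF _ ordLeq_transitive[OF _ card_of_image]] by blast
    then show ?thesis ..
  qed
  then show ?thesis
    using ordLeq_ordIso_trans[OF _ ordIso_symmetric[OF F_size]] by blast
qed

section \<open>The dominating side\<close>

lemma localizing_families_nonempty:
  assumes "\<forall>\<^sub>\<infinity>n. h n \<ge> 1"
  shows "{D. D \<subseteq> slaloms b h \<and> (\<forall>x\<in>Pi UNIV b. \<exists>\<phi>\<in>D. x \<in>\<^sup>* \<phi>)} \<noteq> {}"
  (is "?\<D> \<noteq> {}")
proof -
  \<comment> \<open>The set of all slaloms is a localizing family once each single real can be
    localized.\<close>
  have "slaloms b h \<in> ?\<D>" using slaloms_localizing[OF assms, of _ b] by simp
  then show ?thesis unfolding ex_in_conv[symmetric] by (rule exI)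
qed

lemma dominating_number_le_dLc_UNIV: "\<dd> \<le>o dLc (\<lambda>_. UNIV) h"
  unfolding dLc_def dominating_number_def
proof (rule least_size_mono[OF card_of_fun_le card_of_set_fun_le])
  show "{D. \<forall>x. \<exists>y\<in>D. x \<le>\<^sup>* y} \<noteq> {}" using le_star_refl by blast
  fix D
  assume D: "D \<in> {D. D \<subseteq> slaloms (\<lambda>_. UNIV) h \<and> (\<forall>x\<in>Pi UNIV (\<lambda>_. UNIV). \<exists>\<phi>\<in>D. x \<in>\<^sup>* \<phi>)}"
  let ?E = "(\<lambda>\<phi> n. Max (\<phi> n)) ` D"
  have "\<exists>y\<in>?E. x \<le>\<^sup>* y" for x
  proof -
    obtain \<phi> where "\<phi> \<in> D" "x \<in>\<^sup>* \<phi>" using D by auto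
    with D have "x \<le>\<^sup>* (\<lambda>n. Max (\<phi> n))" by (intro in_star_le_star_Max[of \<phi> h]) auto
    with \<open>\<phi> \<in> D\<close> show ?thesis by (auto intro: bexI[of _ \<phi>])
  qed
  then have "?E \<in> {D. \<forall>x. \<exists>y\<in>D. x \<le>\<^sup>* y}" by simp
  then show "\<exists>A\<in>{D. \<forall>x. \<exists>y\<in>D. x \<le>\<^sup>* y}. |A| \<le>o |D|"
    by (rule bexI[rotated]) (rule card_of_image)
qed

lemma dLc_le_dLc_UNIV:
  assumes "\<forall>\<^sub>\<infinity>n. h n \<ge> 1"
  shows "dLc b h \<le>o dLc (\<lambda>_. UNIV) h"
  unfolding dLc_def
proof (rule least_size_mono[OF card_of_set_fun_le card_of_set_fun_le
      localizing_families_nonempty[OF assms]])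
  fix D
  assume D: "D \<in> {D. D \<subseteq> slaloms (\<lambda>_. UNIV) h \<and> (\<forall>x\<in>Pi UNIV (\<lambda>_. UNIV). \<exists>\<phi>\<in>D. x \<in>\<^sup>* \<phi>)}"
  let ?E = "(\<lambda>\<phi> n. \<phi> n \<inter> b n) ` D"
  have "\<exists>\<phi>\<in>?E. x \<in>\<^sup>* \<phi>" if "x \<in> Pi UNIV b" for x
  proof -
    obtain \<phi> where "\<phi> \<in> D" "x \<in>\<^sup>* \<phi>" using D by auto
    with in_star_restrict[of x \<phi> b] that show ?thesis by (auto intro: bexI[of _ \<phi>])
  qed
  moreover have "?E \<subseteq> slaloms b h" using D by (auto intro: slaloms_restrict)
  ultimately have "?E \<in> {D. D \<subseteq> slaloms b h \<and> (\<forall>x\<in>Pi UNIV b. \<exists>\<phi>\<in>D. x \<in>\<^sup>* \<phi>)}" by simp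
  then show "\<exists>A\<in>{D. D \<subseteq> slaloms b h \<and> (\<forall>x\<in>Pi UNIV b. \<exists>\<phi>\<in>D. x \<in>\<^sup>* \<phi>)}. |A| \<le>o |D|"
    by (rule bexI[rotated]) (rule card_of_image)
qed

text \<open>Stated for any common bound \<open>\<kappa>\<close>, so that the maximum can be inserted
  without knowing which of the two cardinals it is.\<close>

lemma dLc_UNIV_le:
  fixes \<kappa> :: cardinal
  assumes h: "\<forall>\<^sub>\<infinity>n. h n \<ge> 1"
    and \<kappa>: "Card_order \<kappa>" "\<dd> \<le>o \<kappa>" "supLc h \<le>o \<kappa>"
  shows "dLc (\<lambda>_. UNIV) h \<le>o \<kappa>"
proof -
  have "{D. \<forall>x. \<exists>y\<in>D. x \<le>\<^sup>* y} \<noteq> {}" using le_star_refl by blast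
  from least_size[OF this card_of_fun_le] obtain E
    where "E \<in> {D. \<forall>x. \<exists>y\<in>D. x \<le>\<^sup>* y}" and E_size: "\<dd> =o |E|"
    unfolding dominating_number_def by blast
  then have E: "\<forall>x. \<exists>y\<in>E. x \<le>\<^sup>* y" by blast
  let ?b = "\<lambda>y n. {..<Suc (max (y n) (h n))}"
  have "\<exists>D. D \<subseteq> slaloms (?b y) h \<and> (\<forall>x\<in>Pi UNIV (?b y). \<exists>\<phi>\<in>D. x \<in>\<^sup>* \<phi>) \<and> |D| \<le>o \<kappa>" for y
  proof -
    from least_size[OF localizing_families_nonempty[OF h, of "?b y"] card_of_set_fun_le]
    obtain D where D: "D \<subseteq> slaloms (?b y) h" "\<forall>x\<in>Pi UNIV (?b y). \<exists>\<phi>\<in>D. x \<in>\<^sup>* \<phi>"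
      "dLc (?b y) h =o |D|"
      unfolding dLc_def by blast
    note ordIso_symmetric[OF D(3)]
    also have "dLc (?b y) h \<le>o supLc h"
      by (rule dLc_le_supLc) (simp add: less_Suc_eq_le)
    also note \<kappa>(3)
    finally show ?thesis using D(1,2) by (intro exI[of _ D] conjI)
  qed
  then have "\<forall>y. \<exists>D. D \<subseteq> slaloms (?b y) h \<and> (\<forall>x\<in>Pi UNIV (?b y). \<exists>\<phi>\<in>D. x \<in>\<^sup>* \<phi>) \<and> |D| \<le>o \<kappa>" ..
  from choice[OF this] obtain D where "\<forall>y. D y \<subseteq> slaloms (?b y) h \<and>
    (\<forall>x\<in>Pi UNIV (?b y). \<exists>\<phi>\<in>D y. x \<in>\<^sup>* \<phi>) \<and> |D y| \<le>o \<kappa>" ..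
  then have D: "\<And>y. D y \<subseteq> slaloms (?b y) h"
    "\<And>y. \<forall>x\<in>Pi UNIV (?b y). \<exists>\<phi>\<in>D y. x \<in>\<^sup>* \<phi>" "\<And>y. |D y| \<le>o \<kappa>"
    by simp_all
  let ?D = "\<Union>y\<in>E. D y"
  have "?D \<subseteq> slaloms (\<lambda>_. UNIV) h"
    using D(1) slaloms_mono[of _ "?b _" h "\<lambda>_. UNIV"] by blast
  moreover have "\<exists>\<phi>\<in>?D. x \<in>\<^sup>* \<phi>" for x
  proof -
    \<comment> \<open>First dominate x by a member of E, then localize its truncation within the
      family chosen for that member.\<close>
    obtain y where y: "y \<in> E" "x \<le>\<^sup>* y" using E by blast
    obtain \<phi> where "\<phi> \<in> D y" "truncate y x \<in>\<^sup>* \<phi>" using bspec[OF D(2) truncate_in_Pi] by blast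
    then show ?thesis using y in_star_truncate by blast
  qed
  ultimately have "?D \<in> {D. D \<subseteq> slaloms (\<lambda>_. UNIV) h \<and>
      (\<forall>x\<in>Pi UNIV (\<lambda>_. UNIV). \<exists>\<phi>\<in>D. x \<in>\<^sup>* \<phi>)}"
    by blast
  then have "dLc (\<lambda>_. UNIV) h \<le>o |?D|"
    unfolding dLc_def by (rule least_size_le[OF card_of_set_fun_le])
  \<comment> \<open>A union of at most \<open>\<kappa>\<close> sets of size at most
    \<open>\<kappa>\<close>; \<open>\<kappa>\<close> is infinite because it bounds the infinite set
    E.\<close>
  also have "|?D| \<le>o \<kappa>"
  proof (rule card_of_UNION_ordLeq_infinite_Field)
    show E_le: "|E| \<le>o \<kappa>"
      using ordIso_ordLeq_trans[OF ordIso_symmetric[OF E_size] \<kappa>(2)] .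
    have "|E| \<le>o |Field \<kappa>|"
      using ordLeq_ordIso_trans[OF E_le ordIso_symmetric[OF card_of_Field_ordIso[OF \<kappa>(1)]]] .
    then show "infinite (Field \<kappa>)"
      using infinite_dominating[OF E] card_of_ordLeq_infinite by blast
  qed (use \<kappa> D(3) in auto)
  finally show ?thesis .
qed

theorem theorem3p20:
  fixes h :: "nat \<Rightarrow> nat"
  assumes "\<forall>\<^sub>\<infinity>n. h n \<ge> 1"
  shows "bLc (\<lambda>_. UNIV) h =o card_min {\<bb>, minLc h}
       \<and> dLc (\<lambda>_. UNIV) h =o card_max {\<dd>, supLc h}"
proof
  let ?m = "card_min {\<bb>, minLc h}" and ?M = "card_max {\<dd>, supLc h}"
  have m: "?m \<in> {\<bb>, minLc h}" "?m \<le>o \<bb>" "?m \<le>o minLc h"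
    using card_min_pair[OF Card_order_unbounding_number Card_order_minLc] by blast+
  have M: "?M \<in> {\<dd>, supLc h}" "\<dd> \<le>o ?M" "supLc h \<le>o ?M"
    using card_max_pair[OF Card_order_dominating_number Card_order_supLc] by blast+
  have "bLc (\<lambda>_. UNIV) h \<le>o minLc h"
    using minLc(1)[of h] bLc_UNIV_le_bLc by metis
  \<comment> \<open>The minimum is one of the two cardinals, so being below both suffices.\<close>
  then have "bLc (\<lambda>_. UNIV) h \<le>o ?m"
    using m(1) bLc_UNIV_le_unbounding_number by auto
  moreover have "?m \<le>o bLc (\<lambda>_. UNIV) h"
    using unbounding_number_le_or_minLc_le m(2,3) ordLeq_transitive by blast
  ultimately show "bLc (\<lambda>_. UNIV) h =o ?m"
    by (simp add: ordIso_iff_ordLeq)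
  have "supLc h \<le>o dLc (\<lambda>_. UNIV) h"
    by (rule supLc_least[OF Card_order_dLc dLc_le_dLc_UNIV[OF assms]])
  then have "?M \<le>o dLc (\<lambda>_. UNIV) h"
    using M(1) dominating_number_le_dLc_UNIV by auto
  moreover have "dLc (\<lambda>_. UNIV) h \<le>o ?M"
    using dLc_UNIV_le[OF assms _ M(2,3)] M(1) Card_order_dominating_number Card_order_supLc
    by auto
  ultimately show "dLc (\<lambda>_. UNIV) h =o ?M"
    by (simp add: ordIso_iff_ordLeq)
qed

end
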